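(* Let $k\in\{1,2\}$ and let $\bar k$ denote the other element of $\{1,2\}$. Let $X,Y$ be independent exponentially distributed random variables with means $1/\lambda_k$ and $1/\lambda_{\bar k}$ respectively, where $\lambda_k,\lambda_{\bar k}>0$. Let $\sigma_k^2>0$, $p_s>0$, $p_w\ge 0$, and define $$R=\begin{cases}\log_2\big(1+\tfrac{p_sX}{\sigma_k^2}\big), & X>Y,\\[2pt] \log_2\Big(1+\dfrac{p_wX}{p_sX+\sigma_k^2}\Big), & \text{otherwise.}\end{cases}$$ Then $$\mathbb E[R]=\frac{2}{\ln2}\frac{\lambda_k}{\lambda_k+\lambda_{\bar k}}f\Big(\frac{(\lambda_k+\lambda_{\bar k})\sigma_k^2}{p_s}\Big)-\frac1{\ln2}\frac{\lambda_k}{\lambda_k+\lambda_{\bar k}}f\Big(\frac{(\lambda_k+\lambda_{\bar k})\sigma_k^2}{p_s+p_w}\Big)-\frac1{\ln2}f\Big(\frac{\lambda_k\sigma_k^2}{p_s}\Big),$$ where $f(x)=e^x\,\mathrm{Ei}(-x)$ for $x>0$.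
   Context: $\mathrm{Ei}(x)=\int_{-\infty}^x\frac{e^t}{t}\,dt$ for $x<0$. Interpretation: $X=|h_k|^2$ and $Y=|h_{\bar k}|^2$ are the channel gains of users $k$ and $\bar k$ in a two-user downlink NOMA system with equal noise variances; under partial channel state information the base station assigns the fixed power $p_s$ to the currently stronger user and $p_w$ to the currently weaker user, and $R$ is the instantaneous rate of user $k$. *)

theory Defs
  imports "HOL-Probability.Probability"
begin

text \<open>Exponential integral; meaningful only for \<open>x < 0\<close>, where the integrand is absolutely
  integrable on \<open>{..x}\<close> (for \<open>x \<ge> 0\<close> it is not, and the value is a junk value).\<close>

definition Ei :: "real \<Rightarrow> real" where
  "Ei x = (LBINT t:{..x}. exp t / t)"

definition f :: "real \<Rightarrow> real" where
  "f x = exp x * Ei (- x)"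

text \<open>Rate of a user with gain \<open>x\<close> and noise variance \<open>v\<close> when the other user's gain is \<open>y\<close>.\<close>

definition noma_rate :: "real \<Rightarrow> real \<Rightarrow> real \<Rightarrow> real \<Rightarrow> real \<Rightarrow> real" where
  "noma_rate p\<^sub>s p\<^sub>w v x y =
     (if x > y then log 2 (1 + p\<^sub>s * x / v)
      else log 2 (1 + p\<^sub>w * x / (p\<^sub>s * x + v)))"

end

theory Submission
  imports Defs
begin

text \<open>Write \<open>m\<^sub>1 = p\<^sub>s / v\<close> and \<open>m\<^sub>2 = (p\<^sub>s + p\<^sub>w) / v\<close>. Almost surely
  \<open>ln 2 * R = ln (1 + m\<^sub>1 * X) + 1{X \<le> Y} * (ln (1 + m\<^sub>2 * X) - 2 * ln (1 + m\<^sub>1 * X))\<close>.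
  Since \<open>a * exp (- a * x) * P (Y \<ge> x) = a / (a + b) * ((a + b) * exp (- (a + b) * x))\<close>, the
  indicator only changes the rate of the exponential law and adds the factor \<open>a / (a + b)\<close>.
  Everything thus reduces to the mean of \<open>ln (1 + m * X)\<close> for an exponential \<open>X\<close> of rate \<open>c\<close>,
  where \<open>exp (c / m) * Ei (- c / m - c * x) - exp (- c * x) * ln (1 + m * x)\<close> is an antiderivative
  of \<open>c * exp (- c * x) * ln (1 + m * x)\<close> that vanishes at infinity.\<close>

section \<open>The exponential integral on the negative half-line\<close>

lemma set_integrable_exp_atMost: "set_integrable lborel {..b} (exp :: real \<Rightarrow> real)"
proof -
  have "integrable lborel (exponential_density 1)"
    using prob_space.emeasure_space_1[OF prob_space_exponential_density[of 1]]
    by (intro integrableI_nonneg) (auto simp: exponential_density_nonneg emeasure_density)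
  \<comment> \<open>The reflection \<open>t \<mapsto> b - t\<close> carries the unit-rate density to
    \<open>exp (t - b)\<close> on \<open>{..b}\<close>; the factor \<open>exp b\<close> then removes
    the shift.\<close>
  then have "integrable lborel (\<lambda>t. exponential_density 1 (b + (-1) * t))"
    by (subst lborel_integrable_real_affine_iff) auto
  then have "integrable lborel (\<lambda>t. exp b * exponential_density 1 (b + (-1) * t))"
    by simp
  also have "(\<lambda>t. exp b * exponential_density 1 (b + (-1) * t)) = (\<lambda>t. indicator {..b} t *\<^sub>R exp t)"
    by (auto simp: exponential_density_def fun_eq_iff indicator_def exp_diff exp_minus field_simps)
  finally show ?thesis
    unfolding set_integrable_def .
qed

text \<open>On \<open>{..b}\<close> the denominator stays at distance at least
  \<open>\<bar>b\<bar>\<close> from 0, so \<open>exp t / \<bar>b\<bar>\<close> dominates.\<close>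

lemma set_integrable_Ei:
  assumes "b < 0"
  shows "set_integrable lborel {..b} (\<lambda>t::real. exp t / t)"
proof (rule set_integrable_bound)
  show "set_integrable lborel {..b} (\<lambda>t. exp t * (1 / \<bar>b\<bar>))"
    by (intro set_integrable_mult_left set_integrable_exp_atMost)
  show "set_borel_measurable lborel {..b} (\<lambda>t::real. exp t / t)"
    unfolding set_borel_measurable_def by measurable
  show "AE t in lborel. t \<in> {..b} \<longrightarrow> norm (exp t / t) \<le> norm (exp t * (1 / \<bar>b\<bar>))"
    using assms by (intro AE_I2) (auto simp: abs_mult intro!: divide_left_mono mult_neg_neg)
qed

text \<open>This moves the variable endpoint into an integral over a compact interval, where both
  the limit at minus infinity and the derivative of \<open>Ei\<close> can be read off.\<close>

lemma Ei_split:
  assumes "x \<le> b" "b < 0"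
  shows "Ei x = Ei b - (LBINT t:{x..b}. exp t / t)"
proof -
  have "Ei b = (LBINT t:{..<x} \<union> {x..b}. exp t / t)"
    unfolding Ei_def using assms by (intro arg_cong2[where f="\<lambda>A g. set_lebesgue_integral lborel A g"]) auto
  also have "\<dots> = (LBINT t:{..<x}. exp t / t) + (LBINT t:{x..b}. exp t / t)"
    using assms by (intro set_integral_Un set_integrable_subset[OF set_integrable_Ei[of b]]) auto
  also have "(LBINT t:{..<x}. exp t / t) = Ei x"
    unfolding Ei_def set_lebesgue_integral_def using AE_lborel_singleton[of x]
    by (intro integral_cong_AE) (measurable, auto simp: indicator_def elim!: eventually_mono)
  finally show ?thesis by simp
qed

lemma Ei_at_bot: "(Ei \<longlongrightarrow> 0) at_bot"
proof -
  have "((\<lambda>x. Ei (-1) - (LBINT t:{x..-1}. exp t / t)) \<longlongrightarrow> Ei (-1) - Ei (-1)) at_bot"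
    unfolding Ei_def
    by (intro tendsto_intros tendsto_set_lebesgue_integral_at_bot set_integrable_Ei) auto
  moreover have "\<forall>\<^sub>F x in at_bot. Ei x = Ei (-1) - (LBINT t:{x..-1}. exp t / t)"
    using eventually_le_at_bot[of "-1::real"] by eventually_elim (auto intro: Ei_split)
  ultimately show ?thesis
    by (simp add: tendsto_cong)
qed

lemma DERIV_Ei:
  assumes "x < 0"
  shows "(Ei has_real_derivative exp x / x) (at x)"
proof -
  \<comment> \<open>Any \<open>a < x < b < 0\<close> would serve: \<open>[a, b]\<close> is a
    neighbourhood of \<open>x\<close> that avoids the singularity at 0.\<close>
  define a b where "a = x - 1" and "b = x / 2"
  have ab: "a < x" "x < b" "b < 0" using assms by (auto simp: a_def b_def)
  have "((\<lambda>y. integral {y..b} (\<lambda>t::real. exp t / t)) has_real_derivative - (exp x / x)) (at x within {a..b})"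
    using ab by (intro integral_has_real_derivative' continuous_intros) auto
  then have "((\<lambda>y. Ei b - integral {y..b} (\<lambda>t::real. exp t / t)) has_real_derivative exp x / x) (at x within {a..b})"
    by (auto intro!: derivative_eq_intros)
  then have deriv: "((\<lambda>y. Ei b - integral {y..b} (\<lambda>t::real. exp t / t)) has_real_derivative exp x / x) (at x)"
    using ab by (simp add: at_within_Icc_at)
  have eq: "Ei y = Ei b - integral {y..b} (\<lambda>t. exp t / t)" if "y \<in> {a<..<b}" for y
  proof -
    have "set_integrable lborel {y..b} (\<lambda>t::real. exp t / t)"
      using ab by (intro set_integrable_subset[OF set_integrable_Ei[of b]]) auto
    from set_borel_integral_eq_integral(2)[OF this] that ab show ?thesis
      by (subst Ei_split[of y b]) auto
  qed
  show ?thesis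
    by (rule has_field_derivative_transform_within_open[OF deriv open_greaterThanLessThan _ eq[symmetric]])
      (use ab in auto)
qed

section \<open>The mean of a logarithm under an exponential law\<close>

lemma has_bochner_integral_exponential_ln:
  fixes c m :: real
  assumes "c > 0" "m > 0"
  shows "has_bochner_integral lborel (\<lambda>x. exponential_density c x * ln (1 + m * x)) (- f (c / m))"
proof -
  let ?g = "\<lambda>x. c * exp (- c * x) * ln (1 + m * x)"
  \<comment> \<open>Integration by parts leaves \<open>exp (- c * x) * (m / (1 + m * x))\<close>;
    substituting \<open>t = - c / m - c * x\<close> turns this into the integrand of
    \<open>Ei\<close>, with \<open>exp (c / m)\<close> undoing the shift. Since
    \<open>?G 0 = f (c / m)\<close>, the integral is \<open>- f (c / m)\<close>.\<close>
  let ?G = "\<lambda>x. exp (c / m) * Ei (- c / m - c * x) - exp (- c * x) * ln (1 + m * x)"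
  have pos: "1 + m * x > 0" if "x \<ge> 0" for x using assms that by (simp add: add_pos_nonneg)
  have deriv: "(?G has_real_derivative ?g x) (at x)" if "x \<ge> 0" for x
  proof -
    have neg: "- c / m - c * x < 0"
    proof -
      have "c / m > 0" "c * x \<ge> 0" using assms that by auto
      then show ?thesis by simp
    qed
    have E: "exp (c / m) * (exp (- c / m - c * x) / (- c / m - c * x) * (- c)) = exp (- c * x) * (m / (1 + m * x))"
    proof -
      have "exp (c / m) * exp (- c / m - c * x) = exp (- c * x)"
        by (simp flip: exp_add)
      moreover have "(- c) / (- c / m - c * x) = m / (1 + m * x)"
        using assms pos[OF that] neg by (simp add: divide_simps) (simp add: algebra_simps)
      ultimately show ?thesis by (metis (no_types) mult.assoc times_divide_eq_left times_divide_eq_right)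
    qed
    have "((\<lambda>x. exp (c / m) * Ei (- c / m - c * x)) has_real_derivative exp (- c * x) * (m / (1 + m * x))) (at x)"
      unfolding E[symmetric]
      by (rule DERIV_cmult, rule DERIV_chain2[where f=Ei and g="\<lambda>x. - c / m - c * x", OF DERIV_Ei[OF neg]])
        (auto intro!: derivative_eq_intros)
    moreover have "((\<lambda>x. exp (- c * x) * ln (1 + m * x)) has_real_derivative
        exp (- c * x) * (m / (1 + m * x)) - ?g x) (at x)"
      using pos[OF that] by (auto intro!: derivative_eq_intros)
    ultimately have "(?G has_real_derivative exp (- c * x) * (m / (1 + m * x)) - (exp (- c * x) * (m / (1 + m * x)) - ?g x)) (at x)"
      by (rule DERIV_diff)
    then show ?thesis by simp
  qed
  have "((\<lambda>x. exp (- c * x) * ln (1 + m * x)) \<longlongrightarrow> 0) at_top"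
    using assms by real_asymp
  moreover have "filterlim (\<lambda>x. - c / m - c * x) at_bot at_top"
    using assms by real_asymp
  then have "((\<lambda>x. Ei (- c / m - c * x)) \<longlongrightarrow> 0) at_top"
    by (rule filterlim_compose[OF Ei_at_bot])
  ultimately have lim: "(?G \<longlongrightarrow> exp (c / m) * 0 - 0) at_top"
    by (intro tendsto_intros)
  have nonneg: "?g x \<ge> 0" if "x \<ge> 0" for x
    using assms that by simp
  have "(\<integral>\<^sup>+ x. ennreal (?g x) * indicator {0..} x \<partial>lborel) = ennreal (exp (c / m) * 0 - 0 - ?G 0)"
    by (rule nn_integral_FTC_atLeast[OF _ deriv nonneg lim]) auto
  also have "(\<lambda>x. ennreal (?g x) * indicator {0..} x) = (\<lambda>x. ennreal (exponential_density c x * ln (1 + m * x)))"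
    by (auto simp: fun_eq_iff exponential_density_def mult_ac)
  finally have nn: "(\<integral>\<^sup>+ x. ennreal (exponential_density c x * ln (1 + m * x)) \<partial>lborel) = ennreal (- f (c / m))"
    by (simp add: f_def)
  \<comment> \<open>\<open>ennreal\<close> truncates negative reals to 0, so the sign of
    \<open>- f (c / m)\<close> has to be settled separately: \<open>?G\<close> increases to its
    limit 0, hence starts at or below 0.\<close>
  have "?G 0 \<le> ?G x" if "x \<ge> 0" for x
    using deriv nonneg that by (intro DERIV_nonneg_imp_nondecreasing[of 0 x ?G]) auto
  then have "?G 0 \<le> exp (c / m) * 0 - 0"
    by (intro tendsto_lowerbound[OF lim]) (auto intro: eventually_at_top_linorderI)
  then have "0 \<le> - f (c / m)" by (simp add: f_def)
  with nn assms show ?thesis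
    by (intro has_bochner_integral_nn_integral AE_I2) (auto simp: exponential_density_def)
qed

section \<open>Exponential gains restricted to the event \<open>X \<le> Y\<close>\<close>

lemma (in prob_space) exponential_distributed_AE_pos:
  assumes X: "distributed M lborel X (exponential_density l)" and "l > 0"
  shows "AE \<omega> in M. 0 < X \<omega>"
proof -
  have [measurable]: "X \<in> borel_measurable M"
    using distributed_measurable[OF X] by simp
  show ?thesis
    using exponential_distributedD_gt[OF X, of 0] assms(2) by (subst prob_Collect_eq_1[symmetric]) auto
qed

text \<open>Integrating out \<open>Y\<close> first leaves its tail \<open>exp (- b * x)\<close>,
  which merges with the density of \<open>X\<close>. Nonnegativity of \<open>g\<close> allows
  Tonelli and yields integrability together with the value; it is asked only for
  \<open>x \<ge> 0\<close> because the densities vanish elsewhere.\<close>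

lemma (in prob_space) has_bochner_integral_exponential_le:
  assumes X: "distributed M lborel X (exponential_density a)"
    and Y: "distributed M lborel Y (exponential_density b)"
    and indep: "indep_var borel X borel Y"
    and ab: "a > 0" "b > 0"
    and g: "has_bochner_integral lborel (\<lambda>x. exponential_density (a + b) x * g x) I"
    and gm [measurable]: "g \<in> borel_measurable borel"
    and g0: "\<And>x. x \<ge> 0 \<Longrightarrow> 0 \<le> g x"
  shows "has_bochner_integral M (\<lambda>\<omega>. indicator {\<omega>. X \<omega> \<le> Y \<omega>} \<omega> * g (X \<omega>)) (a / (a + b) * I)"
proof -
  have [measurable]: "X \<in> borel_measurable M" "Y \<in> borel_measurable M"
    using X Y by (auto dest: distributed_measurable)
  have tail: "(\<integral>\<^sup>+ y. ennreal (exponential_density b y) * indicator {x..} y \<partial>lborel) = ennreal (exp (- b * x))"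
    if "x \<ge> 0" for x
  proof -
    have "(\<integral>\<^sup>+ y. ennreal (exponential_density b y) * indicator {x..} y \<partial>lborel)
        = (\<integral>\<^sup>+ y. ennreal (b * exp (- b * y)) * indicator {x..} y \<partial>lborel)"
      using that by (intro nn_integral_cong) (auto simp: exponential_density_def indicator_def mult_ac)
    also have "\<dots> = ennreal (0 - (- exp (- b * x)))"
    proof (rule nn_integral_FTC_atLeast)
      show "((\<lambda>y. - exp (- b * y)) \<longlongrightarrow> 0) at_top" using ab by real_asymp
    qed (use ab in \<open>auto intro!: derivative_eq_intros\<close>)
    finally show ?thesis by simp
  qed
  have X0: "AE \<omega> in M. 0 < X \<omega>"
    using X ab(1) by (rule exponential_distributed_AE_pos)
  have meas: "(\<lambda>(x, y). ennreal (indicator {x..} y * g x)) \<in> borel_measurable (lborel \<Otimes>\<^sub>M lborel)"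
  proof -
    \<comment> \<open>The set \<open>{x..}\<close> varies with \<open>x\<close>; as a comparison of
      the two coordinates the condition is visibly jointly measurable.\<close>
    have "(\<lambda>(x, y). ennreal (indicator {x..} y * g x)) =
        (\<lambda>p. ennreal (if fst p \<le> snd p then g (fst p) else 0))"
      by (auto simp: fun_eq_iff)
    also have "\<dots> \<in> borel_measurable (lborel \<Otimes>\<^sub>M lborel)"
      by measurable
    finally show ?thesis .
  qed
  have J: "distributed M (lborel \<Otimes>\<^sub>M lborel) (\<lambda>\<omega>. (X \<omega>, Y \<omega>))
      (\<lambda>(x, y). ennreal (exponential_density a x) * ennreal (exponential_density b y))"
  proof (rule distributed_joint_indep[OF _ _ X Y])
    show "indep_var lborel X lborel Y"
      using indep by (simp add: indep_var_eq)
  qed (rule lborel.sigma_finite_measure_axioms)+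
  have "(\<integral>\<^sup>+ \<omega>. ennreal (indicator {\<omega>. X \<omega> \<le> Y \<omega>} \<omega> * g (X \<omega>)) \<partial>M)
     = (\<integral>\<^sup>+ \<omega>. (\<lambda>(x, y). ennreal (indicator {x..} y * g x)) (X \<omega>, Y \<omega>) \<partial>M)"
    by (auto intro!: nn_integral_cong simp: indicator_def)
  also have "\<dots> = (\<integral>\<^sup>+ p. (\<lambda>(x, y). ennreal (exponential_density a x) * ennreal (exponential_density b y)) p *
      (\<lambda>(x, y). ennreal (indicator {x..} y * g x)) p \<partial>(lborel \<Otimes>\<^sub>M lborel))"
    by (rule distributed_nn_integral[OF J meas, symmetric])
  also have "\<dots> = (\<integral>\<^sup>+ x. \<integral>\<^sup>+ y. ennreal (exponential_density a x) * ennreal (exponential_density b y) *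
      ennreal (indicator {x..} y * g x) \<partial>lborel \<partial>lborel)"
  proof (subst lborel.nn_integral_fst[symmetric])
    have "(\<lambda>(x, y). ennreal (exponential_density a x) * ennreal (exponential_density b y))
        \<in> borel_measurable (lborel \<Otimes>\<^sub>M lborel)"
      by measurable
    then show "(\<lambda>p. (\<lambda>(x, y). ennreal (exponential_density a x) * ennreal (exponential_density b y)) p *
        (\<lambda>(x, y). ennreal (indicator {x..} y * g x)) p) \<in> borel_measurable (lborel \<Otimes>\<^sub>M lborel)"
      using meas by (rule borel_measurable_times_ennreal)
  qed simp
  also have "\<dots> = (\<integral>\<^sup>+ x. ennreal (a / (a + b) * (exponential_density (a + b) x * g x)) \<partial>lborel)"
  proof (rule nn_integral_cong)
    fix x :: real
    show "(\<integral>\<^sup>+ y. ennreal (exponential_density a x) * ennreal (exponential_density b y) *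
      ennreal (indicator {x..} y * g x) \<partial>lborel) = ennreal (a / (a + b) * (exponential_density (a + b) x * g x))"
    proof (cases "x \<ge> 0")
      case True
      have "(\<integral>\<^sup>+ y. ennreal (exponential_density a x) * ennreal (exponential_density b y) *
          ennreal (indicator {x..} y * g x) \<partial>lborel)
        = (\<integral>\<^sup>+ y. ennreal (exponential_density a x * g x) *
            (ennreal (exponential_density b y) * indicator {x..} y) \<partial>lborel)"
        using ab g0[OF True]
        by (intro nn_integral_cong) (auto simp: indicator_def ennreal_mult exponential_density_nonneg mult_ac)
      also have "\<dots> = ennreal (exponential_density a x * g x) * ennreal (exp (- b * x))"
        by (subst nn_integral_cmult) (auto simp: tail[OF True])
      also have "\<dots> = ennreal (exponential_density a x * exp (- b * x) * g x)"
        using ab g0[OF True]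
        by (subst ennreal_mult[symmetric]) (auto simp: exponential_density_nonneg mult_ac)
      \<comment> \<open>The rates add in the exponent, and \<open>a / (a + b)\<close> corrects the
        normalisation from \<open>a\<close> to \<open>a + b\<close>.\<close>
      also have "exponential_density a x * exp (- b * x) = a / (a + b) * exponential_density (a + b) x"
      proof -
        have "exp (- x * (a + b)) = exp (- x * a) * exp (- b * x)"
          by (simp add: algebra_simps flip: exp_add)
        then show ?thesis
          using ab True by (simp add: exponential_density_def)
      qed
      also have "ennreal (a / (a + b) * exponential_density (a + b) x * g x)
          = ennreal (a / (a + b) * (exponential_density (a + b) x * g x))"
        by (simp only: mult.assoc)
      finally show ?thesis .
    qed (auto simp: exponential_density_def)
  qed
  also have "\<dots> = ennreal (a / (a + b) * I)"
  proof -
    have "has_bochner_integral lborel (\<lambda>x. a / (a + b) * (exponential_density (a + b) x * g x)) (a / (a + b) * I)"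
      using g by (rule has_bochner_integral_mult_right)
    then show ?thesis
      using ab g0 by (subst nn_integral_eq_integral)
        (auto simp: has_bochner_integral_iff exponential_density_def)
  qed
  finally have nn: "(\<integral>\<^sup>+ \<omega>. ennreal (indicator {\<omega>. X \<omega> \<le> Y \<omega>} \<omega> * g (X \<omega>)) \<partial>M) = ennreal (a / (a + b) * I)" .
  have "0 \<le> exponential_density (a + b) x * g x" for x
    using ab g0 by (simp add: exponential_density_def)
  then have "0 \<le> integral\<^sup>L lborel (\<lambda>x. exponential_density (a + b) x * g x)"
    by (rule Bochner_Integration.integral_nonneg)
  then have "0 \<le> I"
    using has_bochner_integral_integral_eq[OF g] by simp
  then have "0 \<le> a / (a + b) * I"
    using ab by simp
  moreover have "AE \<omega> in M. 0 \<le> indicator {\<omega>. X \<omega> \<le> Y \<omega>} \<omega> * g (X \<omega>)"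
    using X0 by eventually_elim (simp add: g0)
  ultimately show ?thesis
    using nn by (intro has_bochner_integral_nn_integral) auto
qed

theorem proposition3p3:
  fixes M :: "'a measure" and X Y R :: "'a \<Rightarrow> real"
    and k kbar :: nat and lam sigma :: "nat \<Rightarrow> real" and p\<^sub>s p\<^sub>w :: real
  assumes "prob_space M"
    and "k \<in> {1, 2}" and "kbar \<in> {1, 2}" and "kbar \<noteq> k"
    and "lam k > 0" and "lam kbar > 0"
    and "distributed M lborel X (exponential_density (lam k))"
    and "distributed M lborel Y (exponential_density (lam kbar))"
    and "prob_space.indep_var M borel X borel Y"
    and "(sigma k)\<^sup>2 > 0" and "p\<^sub>s > 0" and "p\<^sub>w \<ge> 0"
    and R_def: "\<And>\<omega>. R \<omega> = noma_rate p\<^sub>s p\<^sub>w ((sigma k)\<^sup>2) (X \<omega>) (Y \<omega>)"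
  shows "integrable M R \<and>
    prob_space.expectation M R =
      2 / ln 2 * (lam k / (lam k + lam kbar)) * f ((lam k + lam kbar) * (sigma k)\<^sup>2 / p\<^sub>s)
      - 1 / ln 2 * (lam k / (lam k + lam kbar)) * f ((lam k + lam kbar) * (sigma k)\<^sup>2 / (p\<^sub>s + p\<^sub>w))
      - 1 / ln 2 * f (lam k * (sigma k)\<^sup>2 / p\<^sub>s)"
proof -
  interpret prob_space M by fact
  define a b v where "a = lam k" and "b = lam kbar" and "v = (sigma k)\<^sup>2"
  define L where "L m x = ln (1 + m * x)" for m x :: real
  define m\<^sub>1 m\<^sub>2 where "m\<^sub>1 = p\<^sub>s / v" and "m\<^sub>2 = (p\<^sub>s + p\<^sub>w) / v"
  \<comment> \<open>Ties count as weak, matching the second branch of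
    \<open>noma_rate\<close>.\<close>
  define weak where "weak \<omega> = (indicator {\<omega>. X \<omega> \<le> Y \<omega>} \<omega> :: real)" for \<omega>
  have pos: "a > 0" "b > 0" "v > 0" "p\<^sub>s > 0" "p\<^sub>w \<ge> 0" "m\<^sub>1 > 0" "m\<^sub>2 > 0"
    using assms by (auto simp: a_def b_def v_def m\<^sub>1_def m\<^sub>2_def intro!: divide_pos_pos add_pos_nonneg)
  have X: "distributed M lborel X (exponential_density a)"
    and Y: "distributed M lborel Y (exponential_density b)"
    using assms by (auto simp: a_def b_def)
  have [measurable]: "X \<in> borel_measurable M" "Y \<in> borel_measurable M"
    using distributed_measurable[OF X] distributed_measurable[OF Y] by auto
  have [measurable]: "L m \<in> borel_measurable borel" for m
    unfolding L_def by measurable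
  have L_integral: "has_bochner_integral M (\<lambda>\<omega>. L m (X \<omega>)) (- f (a / m))" if "m > 0" for m
    using has_bochner_integral_exponential_ln[OF \<open>a > 0\<close> that]
      distributed_integrable[OF X, of "L m"] distributed_integral[OF X, of "L m"]
    by (auto simp: has_bochner_integral_iff L_def exponential_density_nonneg pos)
  have weak_integral: "has_bochner_integral M (\<lambda>\<omega>. weak \<omega> * L m (X \<omega>)) (a / (a + b) * - f ((a + b) / m))"
    if "m > 0" for m
    unfolding weak_def using pos that
    by (intro has_bochner_integral_exponential_le[OF X Y assms(9)])
      (auto simp: L_def intro!: has_bochner_integral_exponential_ln)
  \<comment> \<open>The strong branch is \<open>L m\<^sub>1\<close>. The weak branch is
    \<open>L m\<^sub>2 - L m\<^sub>1\<close>, because its argument is the quotient of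
    \<open>1 + m\<^sub>2 * X\<close> by \<open>1 + m\<^sub>1 * X\<close>. Switching branches
    therefore adds \<open>L m\<^sub>2 - 2 * L m\<^sub>1\<close>. Positivity of \<open>X\<close>
    keeps all arguments of \<open>ln\<close> positive.\<close>
  have rate: "AE \<omega> in M. R \<omega> =
      1 / ln 2 * (L m\<^sub>1 (X \<omega>) + weak \<omega> * L m\<^sub>2 (X \<omega>) - 2 * (weak \<omega> * L m\<^sub>1 (X \<omega>)))"
    using exponential_distributed_AE_pos[OF X \<open>a > 0\<close>]
  proof eventually_elim
    case (elim \<omega>)
    have p: "1 + m\<^sub>1 * X \<omega> > 0" "1 + m\<^sub>2 * X \<omega> > 0"
      using pos elim by (simp_all add: add_pos_pos)
    have "1 + p\<^sub>w * X \<omega> / (p\<^sub>s * X \<omega> + v) = (1 + m\<^sub>2 * X \<omega>) / (1 + m\<^sub>1 * X \<omega>)"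
    proof -
      have "p\<^sub>s * X \<omega> + v > 0" using pos elim by (simp add: add_pos_pos)
      moreover have num: "1 + m\<^sub>1 * X \<omega> = (p\<^sub>s * X \<omega> + v) / v"
        "1 + m\<^sub>2 * X \<omega> = (p\<^sub>s * X \<omega> + v + p\<^sub>w * X \<omega>) / v"
        using pos by (simp_all add: m\<^sub>1_def m\<^sub>2_def field_simps)
      ultimately show ?thesis
        unfolding num using pos by (simp add: divide_simps)
    qed
    moreover have "1 + p\<^sub>s * X \<omega> / v = 1 + m\<^sub>1 * X \<omega>"
      by (simp add: m\<^sub>1_def)
    moreover have "ln ((1 + m\<^sub>2 * X \<omega>) / (1 + m\<^sub>1 * X \<omega>)) = L m\<^sub>2 (X \<omega>) - L m\<^sub>1 (X \<omega>)"
      using p by (simp add: L_def ln_div)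
    ultimately show ?case
      by (auto simp: R_def noma_rate_def v_def[symmetric] L_def weak_def log_def
          simp flip: diff_divide_distrib)
  qed
  have "has_bochner_integral M
      (\<lambda>\<omega>. 1 / ln 2 * (L m\<^sub>1 (X \<omega>) + weak \<omega> * L m\<^sub>2 (X \<omega>) - 2 * (weak \<omega> * L m\<^sub>1 (X \<omega>))))
      (1 / ln 2 * (- f (a / m\<^sub>1) + a / (a + b) * - f ((a + b) / m\<^sub>2) - 2 * (a / (a + b) * - f ((a + b) / m\<^sub>1))))"
    using pos by (intro has_bochner_integral_mult_right has_bochner_integral_add
        has_bochner_integral_diff L_integral weak_integral)
  moreover have "R \<in> borel_measurable M"
    unfolding R_def noma_rate_def by measurable
  ultimately have "has_bochner_integral M R
      (1 / ln 2 * (- f (a / m\<^sub>1) + a / (a + b) * - f ((a + b) / m\<^sub>2) - 2 * (a / (a + b) * - f ((a + b) / m\<^sub>1))))"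
    using rate by (subst has_bochner_integral_cong_AE) (auto simp: has_bochner_integral_iff weak_def)
  \<comment> \<open>Here \<open>q\<close> is \<open>a / (a + b)\<close>, and \<open>A\<close>,
    \<open>B\<close>, \<open>C\<close> are the values of \<open>f\<close> at
    \<open>a / m\<^sub>1\<close>, \<open>(a + b) / m\<^sub>2\<close> and
    \<open>(a + b) / m\<^sub>1\<close>.\<close>
  moreover have "1 / ln 2 * (- A + q * - B - 2 * (q * - C)) = 2 / ln 2 * q * C - 1 / ln 2 * q * B - 1 / ln 2 * A"
    for A B C q :: real
    by (simp add: field_simps)
  ultimately show ?thesis
    by (simp only: has_bochner_integral_iff a_def b_def v_def m\<^sub>1_def m\<^sub>2_def divide_divide_eq_right)
qed

end
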